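(* Let $A$ be a row-finite $\omega\times\omega$ matrix over a field $\mathcal F$, let $Q$ be a non-singular row-finite $\omega\times\omega$ matrix such that $H=(h_{ki}):=Q\cdot A$ is in quasi-Hermite form, let $J$ and $W$ be the sets of indices of nonzero and of zero rows of $H$, let $\rho_j$ be the length of the row $H_j$ for $j\in J$, and let $\mathfrak R(H)=\{\rho_j: j\in J\}$. Let $c\in\mathcal F^\omega$ and $\kappa=(\kappa_n)_{n\in\omega}:=Q\cdot c\in\mathcal F^\omega$. Consider the infinite linear system $A\cdot x=c$ in the unknown $x=(x_m)_{m\in\omega}\in\mathcal F^\omega$ (column vector). Then: (a) The system $A\cdot x=c$ is consistent if and only if $\kappa_w=0$ for all $w\in W$. (b) If it is consistent, a particular solution is the sequence $x_{\mathcal P}$ whose entry at position $\rho_j$ is $\kappa_j$ for each $j\in J$ and whose other entries are $0$, and its general solution is $$x_m=\begin{cases} t_m \ (\text{free variable in }\mathcal F) & \text{if } m\in\omega\setminus\mathfrak R(H),\\[4pt] \displaystyle \kappa_j-\sum_{\substack{0\le s\le \rho_j-1\\ s\notin\mathfrak R(H)}} h_{js}\,t_s & \text{if } m=\rho_j,\ j\in J.\end{cases}$$ In particular the general solution of the homogeneous system $A\cdot x=\mathbf 0$ is given by this formula with all $\kappa_j=0$. (c) The number of free variables, $\mathrm{card}(\omega\setminus\mathfrak R(H))$, equals the deficiency $\mathrm{def}(A)$; nontrivial solutions of the homogeneous system $A\cdot x=\mathbf 0$ exist if and only if $\mathrm{def}(A)>0$.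
   Context: $\omega=\{0,1,2,\dots\}$. $\mathcal F^{\omega}$ is the space of all infinite sequences in $\mathcal F$, viewed as column vectors, and $\mathcal F^{(\omega)}$ is the subspace of sequences with finitely many nonzero terms. A row-finite $\omega\times\omega$ matrix is a sequence $A=(A_k)_{k\in\omega}$ of rows $A_k\in\mathcal F^{(\omega)}$; products of row-finite matrices, and of a row-finite matrix with a column in $\mathcal F^\omega$, are defined as usual by finite sums. A row-finite matrix is non-singular if it has a two-sided inverse that is a row-finite matrix. The length of a nonzero row is the largest index of a nonzero entry. $\mathrm{def}(A)$ is the codimension in $\mathcal F^{(\omega)}$ of the row space $\mathrm{RS}(A)$ (the span of the rows of $A$). Quasi-Hermite form: a row-finite matrix $H=(h_{ki})$ with set $J$ of indices of nonzero rows and $\rho_j$ the length of $H_j$ is in quasi-Hermite form if $(\rho_j)_{j\in J}$ is strictly increasing, $h_{j\rho_j}=1$ for all $j\in J$, and $h_{k\rho_j}=0$ whenever $j\in J$, $k\in\omega$, $j<k$. *)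

theory Defs
  imports Complex_Main "HOL-Library.Poly_Mapping" "HOL-Library.Set_Algebras"
begin

unbundle cardinal_syntax

text \<open>The space of finitely supported sequences is the type \<open>nat \<Rightarrow>\<^sub>0 'a\<close>; columns are arbitrary
  sequences \<open>nat \<Rightarrow> 'a\<close>. The multiplication that \<open>HOL-Library.Poly_Mapping\<close> puts on
  \<open>nat \<Rightarrow>\<^sub>0 'a\<close> (convolution) plays no role.\<close>

type_synonym 'a rf_matrix = "nat \<Rightarrow> (nat \<Rightarrow>\<^sub>0 'a)"

definition row_scale :: "'a::field \<Rightarrow> (nat \<Rightarrow>\<^sub>0 'a) \<Rightarrow> (nat \<Rightarrow>\<^sub>0 'a)" where
  "row_scale a r = Poly_Mapping.map (\<lambda>b. a * b) r"

lemma lookup_row_scale [simp]: "Poly_Mapping.lookup (row_scale a r) i = a * Poly_Mapping.lookup r i"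
  by (simp add: row_scale_def Poly_Mapping.map.rep_eq when_def)

definition rf_mult :: "'a::field rf_matrix \<Rightarrow> 'a rf_matrix \<Rightarrow> 'a rf_matrix" (infixl \<open>\<odot>\<close> 70) where
  "A \<odot> B = (\<lambda>k. \<Sum>i\<in>Poly_Mapping.keys (A k). row_scale (Poly_Mapping.lookup (A k) i) (B i))"

definition rf_mult_col :: "'a::field rf_matrix \<Rightarrow> (nat \<Rightarrow> 'a) \<Rightarrow> (nat \<Rightarrow> 'a)" (infixl \<open>\<odot>v\<close> 70) where
  "A \<odot>v x = (\<lambda>k. \<Sum>i\<in>Poly_Mapping.keys (A k). Poly_Mapping.lookup (A k) i * x i)"

definition rf_one :: "'a::field rf_matrix" where
  "rf_one = (\<lambda>k. Poly_Mapping.single k 1)"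

definition nonsingular :: "'a::field rf_matrix \<Rightarrow> bool" where
  "nonsingular Q \<longleftrightarrow> (\<exists>P. Q \<odot> P = rf_one \<and> P \<odot> Q = rf_one)"

text \<open>Only meaningful for a nonzero row.\<close>

definition row_length :: "(nat \<Rightarrow>\<^sub>0 'a::zero) \<Rightarrow> nat" where
  "row_length r = Max (Poly_Mapping.keys r)"

definition nonzero_rows :: "'a::field rf_matrix \<Rightarrow> nat set" where
  "nonzero_rows H = {k. H k \<noteq> 0}"

definition zero_rows :: "'a::field rf_matrix \<Rightarrow> nat set" where
  "zero_rows H = {k. H k = 0}"

definition length_set :: "'a::field rf_matrix \<Rightarrow> nat set" where
  "length_set H = {row_length (H j) |j. j \<in> nonzero_rows H}"

definition quasi_Hermite :: "'a::field rf_matrix \<Rightarrow> bool" where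
  "quasi_Hermite H \<longleftrightarrow>
     strict_mono_on (nonzero_rows H) (\<lambda>j. row_length (H j)) \<and>
     (\<forall>j\<in>nonzero_rows H. Poly_Mapping.lookup (H j) (row_length (H j)) = 1) \<and>
     (\<forall>j\<in>nonzero_rows H. \<forall>k>j. Poly_Mapping.lookup (H k) (row_length (H j)) = 0)"

text \<open>For a length \<open>m\<close>, the index \<open>j\<close> of the nonzero row with \<open>row_length (H j) = m\<close>.\<close>

definition row_of_length :: "'a::field rf_matrix \<Rightarrow> nat \<Rightarrow> nat" where
  "row_of_length H = the_inv_into (nonzero_rows H) (\<lambda>j. row_length (H j))"

lemma row_of_length:
  assumes "quasi_Hermite H" "j \<in> nonzero_rows H"
  shows "row_of_length H (row_length (H j)) = j"
  using assms unfolding row_of_length_def quasi_Hermite_def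
  by (metis (no_types, lifting) strict_mono_on_imp_inj_on the_inv_into_f_f)

definition particular_solution :: "'a::field rf_matrix \<Rightarrow> (nat \<Rightarrow> 'a) \<Rightarrow> (nat \<Rightarrow> 'a)" where
  "particular_solution H \<kappa> =
     (\<lambda>m. if m \<in> length_set H then \<kappa> (row_of_length H m) else 0)"

text \<open>Only the values of \<open>t\<close> outside \<open>length_set H\<close>, the free variables, are used.\<close>

definition general_solution ::
    "'a::field rf_matrix \<Rightarrow> (nat \<Rightarrow> 'a) \<Rightarrow> (nat \<Rightarrow> 'a) \<Rightarrow> (nat \<Rightarrow> 'a)" where
  "general_solution H \<kappa> t =
     (\<lambda>m. if m \<in> length_set H
          then let j = row_of_length H m in
            \<kappa> j - (\<Sum>s | s < m \<and> s \<notin> length_set H. Poly_Mapping.lookup (H j) s * t s)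
          else t m)"

interpretation row_space: vector_space "row_scale :: 'a::field \<Rightarrow> (nat \<Rightarrow>\<^sub>0 'a) \<Rightarrow> (nat \<Rightarrow>\<^sub>0 'a)"
  by unfold_locales (auto intro!: poly_mapping_eqI simp: lookup_add algebra_simps)

definition RS :: "'a::field rf_matrix \<Rightarrow> (nat \<Rightarrow>\<^sub>0 'a) set" where
  "RS A = row_space.span (range A)"

text \<open>The quotient by a subspace \<open>W\<close> is the set of cosets of \<open>W\<close>. Sums of sets are those of
  \<open>HOL-Library.Set_Algebras\<close>; the summand \<open>W\<close> in a linear combination of cosets turns the
  elementwise linear combination into a coset also when it is empty or has zero coefficients.\<close>

definition quotient_space :: "(nat \<Rightarrow>\<^sub>0 'a::field) set \<Rightarrow> (nat \<Rightarrow>\<^sub>0 'a) set set" where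
  "quotient_space W = {v +o W |v. True}"

definition quotient_comb ::
    "(nat \<Rightarrow>\<^sub>0 'a::field) set \<Rightarrow> (nat \<Rightarrow>\<^sub>0 'a) set set \<Rightarrow> ((nat \<Rightarrow>\<^sub>0 'a) set \<Rightarrow> 'a) \<Rightarrow> (nat \<Rightarrow>\<^sub>0 'a) set" where
  "quotient_comb W S a = W + (\<Sum>X\<in>S. row_scale (a X) ` X)"

definition quotient_basis :: "(nat \<Rightarrow>\<^sub>0 'a::field) set \<Rightarrow> (nat \<Rightarrow>\<^sub>0 'a) set set \<Rightarrow> bool" where
  "quotient_basis W B \<longleftrightarrow>
     B \<subseteq> quotient_space W \<and>
     (\<forall>S a. finite S \<and> S \<subseteq> B \<and> quotient_comb W S a = W \<longrightarrow> (\<forall>X\<in>S. a X = 0)) \<and>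
     (\<forall>Y\<in>quotient_space W. \<exists>S a. finite S \<and> S \<subseteq> B \<and> Y = quotient_comb W S a)"

text \<open>The cardinality of a basis of the quotient: a cardinal number, possibly infinite, and, as
  usual for HOL cardinals, meaningful up to \<open>=o\<close>.\<close>

definition codim :: "(nat \<Rightarrow>\<^sub>0 'a::field) set \<Rightarrow> (nat \<Rightarrow>\<^sub>0 'a) set rel" where
  "codim W = |SOME B. quotient_basis W B|"

definition deficiency :: "'a::field rf_matrix \<Rightarrow> (nat \<Rightarrow>\<^sub>0 'a) set rel" where
  "deficiency A = codim (RS A)"

end

theory Submission
  imports Defs
begin

text \<open>
  Since \<open>Q\<close> is invertible, \<open>A\<close> and \<open>H = Q \<odot> A\<close> have the same row space, and \<open>A \<odot>v x = c\<close> is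
  equivalent to \<open>H \<odot>v x = \<kappa>\<close>. In quasi-Hermite form the column \<open>\<rho>\<^sub>j\<close> of \<open>H\<close> is a unit vector: the
  entries below the leading one vanish by definition, and those above it vanish because the
  earlier rows are shorter (\<open>quasi_Hermite_pivot_column\<close>). So the \<open>j\<close>-th equation of
  \<open>H \<odot>v x = \<kappa>\<close> involves only one pivot variable, namely \<open>x \<rho>\<^sub>j\<close>, with coefficient \<open>1\<close>, and it
  can be solved for that variable whatever the values of the others
  (\<open>quasi_Hermite_row_equation\<close>), while the zero rows give the consistency conditions. This is
  parts (a) and (b).

  For the deficiency, subtract from a finitely supported row \<open>v\<close> the multiples of the rows of \<open>H\<close>
  that clear its entries at the pivot positions. This reduction is linear, its kernel is the row
  space of \<open>H\<close>, and its range is spanned by the unit vectors at the non-pivot positions. The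
  quotient by the kernel has the dimension of the range (\<open>codim_kernel\<close>), which gives (c). The
  invariance of dimension that this needs, for possibly infinite bases, is
  \<open>row_space.bij_if_span_eq_span_bases\<close>, applied in the range after every basis of the quotient
  has been transported there; hence the choice of the basis in \<open>codim\<close> does not matter.
\<close>

section \<open>Linear combinations of the rows of a matrix\<close>

definition row_comb :: "(nat \<Rightarrow>\<^sub>0 'a::field) \<Rightarrow> 'a rf_matrix \<Rightarrow> (nat \<Rightarrow>\<^sub>0 'a)" where
  "row_comb v B = (\<Sum>i\<in>Poly_Mapping.keys v. row_scale (Poly_Mapping.lookup v i) (B i))"

definition row_dot :: "(nat \<Rightarrow>\<^sub>0 'a::field) \<Rightarrow> (nat \<Rightarrow> 'a) \<Rightarrow> 'a" where
  "row_dot v x = (\<Sum>i\<in>Poly_Mapping.keys v. Poly_Mapping.lookup v i * x i)"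

lemma rf_mult_row_comb: "(A \<odot> B) k = row_comb (A k) B"
  by (simp add: rf_mult_def row_comb_def)

lemma rf_mult_col_row_dot: "(A \<odot>v x) k = row_dot (A k) x"
  by (simp add: rf_mult_col_def row_dot_def)

lemma row_comb_superset:
  assumes "finite S" "Poly_Mapping.keys v \<subseteq> S"
  shows "row_comb v B = (\<Sum>i\<in>S. row_scale (Poly_Mapping.lookup v i) (B i))"
  unfolding row_comb_def using assms
  by (intro sum.mono_neutral_left) (auto simp: in_keys_iff)

lemma row_dot_superset:
  assumes "finite S" "Poly_Mapping.keys v \<subseteq> S"
  shows "row_dot v x = (\<Sum>i\<in>S. Poly_Mapping.lookup v i * x i)"
  unfolding row_dot_def using assms
  by (intro sum.mono_neutral_left) (auto simp: in_keys_iff)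

lemma keys_row_scale: "Poly_Mapping.keys (row_scale a v) \<subseteq> Poly_Mapping.keys v"
  by (auto simp: in_keys_iff)

lemma row_comb_add: "row_comb (u + v) B = row_comb u B + row_comb v B"
proof -
  let ?S = "Poly_Mapping.keys u \<union> Poly_Mapping.keys v"
  have "Poly_Mapping.keys (u + v) \<subseteq> ?S" by (rule keys_add)
  then show ?thesis
    by (simp add: row_comb_superset[of ?S] lookup_add row_space.scale_left_distrib sum.distrib)
qed

lemma row_comb_scale: "row_comb (row_scale a v) B = row_scale a (row_comb v B)"
  by (simp add: row_comb_superset[OF finite_keys keys_row_scale]
      row_comb_def[of v] row_space.scale_sum_right)

lemma row_dot_add: "row_dot (u + v) x = row_dot u x + row_dot v x"
proof -
  let ?S = "Poly_Mapping.keys u \<union> Poly_Mapping.keys v"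
  have "Poly_Mapping.keys (u + v) \<subseteq> ?S" by (rule keys_add)
  then show ?thesis
    by (simp add: row_dot_superset[of ?S] lookup_add distrib_right sum.distrib)
qed

lemma row_dot_scale: "row_dot (row_scale a v) x = a * row_dot v x"
  by (simp add: row_dot_superset[OF finite_keys keys_row_scale]
      row_dot_def[of v] sum_distrib_left mult.assoc)

lemma row_comb_sum: "row_comb (\<Sum>i\<in>S. g i) B = (\<Sum>i\<in>S. row_comb (g i) B)"
  by (induction S rule: infinite_finite_induct) (simp_all add: row_comb_add, simp_all add: row_comb_def)

lemma row_dot_sum: "row_dot (\<Sum>i\<in>S. g i) x = (\<Sum>i\<in>S. row_dot (g i) x)"
  by (induction S rule: infinite_finite_induct) (simp_all add: row_dot_add, simp_all add: row_dot_def)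

lemma row_comb_rf_one [simp]: "row_comb v rf_one = v"
proof (rule poly_mapping_eqI)
  fix k
  have "Poly_Mapping.lookup (row_comb v rf_one) k
      = (\<Sum>i\<in>Poly_Mapping.keys v. if i = k then Poly_Mapping.lookup v i else 0)"
    unfolding row_comb_def rf_one_def lookup_sum
    by (intro sum.cong) (auto simp: lookup_single when_def)
  then show "Poly_Mapping.lookup (row_comb v rf_one) k = Poly_Mapping.lookup v k"
    by (simp add: in_keys_iff)
qed

lemma row_comb_single [simp]: "row_comb (Poly_Mapping.single m 1) B = B m"
  by (simp add: row_comb_def)

lemma row_dot_single [simp]: "row_dot (Poly_Mapping.single m 1) x = x m"
  by (simp add: row_dot_def)

lemma row_comb_rf_mult: "row_comb v (A \<odot> B) = row_comb (row_comb v A) B"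
  by (simp add: row_comb_def[of v] row_comb_sum row_comb_scale rf_mult_row_comb)

lemma rf_mult_assoc: "A \<odot> (B \<odot> C) = (A \<odot> B) \<odot> C"
  by (rule ext) (simp add: rf_mult_row_comb row_comb_rf_mult)

lemma rf_one_mult: "rf_one \<odot> A = A"
  by (rule ext) (simp add: rf_mult_row_comb, simp add: rf_one_def)

lemma rf_mult_col_assoc: "A \<odot>v (B \<odot>v x) = (A \<odot> B) \<odot>v x"
  by (rule ext) (simp add: rf_mult_col_row_dot rf_mult_row_comb row_comb_def row_dot_sum
      row_dot_scale row_dot_def[of "A _" "B \<odot>v x"])

lemma rf_one_mult_col: "rf_one \<odot>v x = x"
  by (rule ext) (simp add: rf_mult_col_row_dot, simp add: rf_one_def)

lemma nonsingular_mult_col_eq_iff: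
  assumes "nonsingular Q"
  shows "A \<odot>v x = c \<longleftrightarrow> (Q \<odot> A) \<odot>v x = Q \<odot>v c"
  using assms unfolding nonsingular_def
  by (metis rf_mult_col_assoc rf_one_mult_col)

lemma row_comb_in_RS: "row_comb v A \<in> RS A"
  unfolding row_comb_def RS_def
  by (intro row_space.span_sum row_space.span_scale row_space.span_base) auto

lemma RS_mult_subset: "RS (Q \<odot> A) \<subseteq> RS A"
proof -
  have "range (Q \<odot> A) \<subseteq> RS A" by (auto simp: rf_mult_row_comb row_comb_in_RS)
  then show ?thesis
    unfolding RS_def[of "Q \<odot> A"] by (rule row_space.span_minimal) (simp add: RS_def)
qed

lemma RS_nonsingular_mult:
  assumes "nonsingular Q"
  shows "RS (Q \<odot> A) = RS A"
proof
  obtain P where "P \<odot> Q = rf_one" using assms unfolding nonsingular_def by blast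
  then have "P \<odot> (Q \<odot> A) = A" by (simp add: rf_mult_assoc rf_one_mult)
  then show "RS A \<subseteq> RS (Q \<odot> A)" by (metis RS_mult_subset)
qed (rule RS_mult_subset)

section \<open>The codimension of a kernel\<close>

text \<open>The summand \<open>W\<close> in \<open>quotient_comb\<close> is what the multiples of \<open>W\<close> in the other summands, which
  shrink to \<open>{0}\<close> for a zero coefficient, are absorbed into.\<close>

lemma quotient_comb_coset:
  assumes W: "row_space.subspace W" and "finite S"
    and coset: "\<And>X. X \<in> S \<Longrightarrow> X = r X +o W"
  shows "quotient_comb W S a = (\<Sum>X\<in>S. row_scale (a X) (r X)) +o W"
  unfolding quotient_comb_def using assms(2) coset
proof (induction S)
  case empty
  show ?case by (simp add: set_zero)
next
  case (insert X S)
  let ?T = "\<Sum>X\<in>S. row_scale (a X) ` X" and ?u = "\<Sum>X\<in>S. row_scale (a X) (r X)"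
  have IH: "W + ?T = ?u +o W" using insert by blast
  have X: "X = r X +o W" using insert.prems by blast
  have absorb: "row_scale (a X) ` X + (?u +o W) = (row_scale (a X) (r X) + ?u) +o W"
  proof (intro set_eqI iffI)
    fix v assume "v \<in> row_scale (a X) ` X + (?u +o W)"
    then obtain w w' where w: "w \<in> W" "w' \<in> W" "v = row_scale (a X) (r X + w) + (?u + w')"
      by (subst (asm) X) (auto simp: set_plus_def elt_set_plus_def)
    then have "row_scale (a X) w + w' \<in> W"
      using W by (simp add: row_space.subspace_add row_space.subspace_scale)
    moreover have "v = (row_scale (a X) (r X) + ?u) + (row_scale (a X) w + w')"
      by (simp add: w(3) row_space.scale_right_distrib ac_simps)
    ultimately show "v \<in> (row_scale (a X) (r X) + ?u) +o W"
      by (auto simp: elt_set_plus_def)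
  next
    fix v assume "v \<in> (row_scale (a X) (r X) + ?u) +o W"
    then obtain w where w: "w \<in> W" "v = (row_scale (a X) (r X) + ?u) + w"
      by (auto simp: elt_set_plus_def)
    have "r X + 0 \<in> X"
      by (subst (2) X) (use W row_space.subspace_0 in \<open>auto simp: elt_set_plus_def\<close>)
    then have "row_scale (a X) (r X) \<in> row_scale (a X) ` X" by auto
    moreover have "?u + w \<in> ?u +o W" using w by auto
    ultimately show "v \<in> row_scale (a X) ` X + (?u +o W)"
      by (subst w(2), subst add.assoc) (rule set_plus_intro)
  qed
  have "W + (\<Sum>X\<in>insert X S. row_scale (a X) ` X) = row_scale (a X) ` X + (W + ?T)"
    using insert.hyps by (simp add: ac_simps)
  also have "\<dots> = (\<Sum>X\<in>insert X S. row_scale (a X) (r X)) +o W"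
    unfolding IH absorb using insert.hyps by simp
  finally show ?case .
qed

text \<open>A linear map identifies the quotient by its kernel with its range: a coset corresponds to the
  common value of the map on it, here taken at an arbitrary representative.\<close>

definition coset_value :: "((nat \<Rightarrow>\<^sub>0 'a::field) \<Rightarrow> 'b) \<Rightarrow> (nat \<Rightarrow>\<^sub>0 'a) set \<Rightarrow> 'b" where
  "coset_value f X = f (SOME v. v \<in> X)"

context
  fixes f :: "(nat \<Rightarrow>\<^sub>0 'a::field) \<Rightarrow> (nat \<Rightarrow>\<^sub>0 'a)" and W
  assumes lin: "Vector_Spaces.linear row_scale row_scale f"
    and W: "W = {v. f v = 0}"
begin

interpretation f: Vector_Spaces.linear row_scale row_scale f by (rule lin)

lemma kernel_coset: "v +o W = f -` {f v}"
proof (intro set_eqI iffI)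
  fix u assume "u \<in> f -` {f v}"
  then have "u - v \<in> W" by (simp add: W f.diff)
  then have "v + (u - v) \<in> v +o W" by (rule set_plus_intro2)
  moreover have "v + (u - v) = u" by simp
  ultimately show "u \<in> v +o W" by metis
qed (auto simp: W elt_set_plus_def f.add)

lemma coset_value_coset: "coset_value f (v +o W) = f v"
proof -
  have "v \<in> v +o W" by (simp add: kernel_coset)
  then have "(SOME u. u \<in> v +o W) \<in> v +o W" by (rule someI)
  then show ?thesis by (simp add: kernel_coset coset_value_def)
qed

lemma inj_on_coset_value: "inj_on (coset_value f) (quotient_space W)"
  by (rule inj_onI) (auto simp: quotient_space_def coset_value_coset, auto simp: kernel_coset)

lemma coset_value_quotient_space: "coset_value f ` quotient_space W = range f"
  by (force simp: quotient_space_def coset_value_coset)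

lemma quotient_comb_in_quotient_space:
  assumes "finite S" "S \<subseteq> quotient_space W"
  shows "quotient_comb W S a \<in> quotient_space W"
    and "coset_value f (quotient_comb W S a) = (\<Sum>X\<in>S. row_scale (a X) (coset_value f X))"
proof -
  obtain r where r: "\<And>X. X \<in> S \<Longrightarrow> X = r X +o W"
    using assms(2) unfolding quotient_space_def by (simp add: subset_eq) metis
  have sub: "row_space.subspace W" unfolding W by (rule f.subspace_kernel)
  have comb: "quotient_comb W S a = (\<Sum>X\<in>S. row_scale (a X) (r X)) +o W"
    using quotient_comb_coset[OF sub assms(1) r] .
  have val: "coset_value f X = f (r X)" if "X \<in> S" for X
    using r[OF that] coset_value_coset by metis
  show "quotient_comb W S a \<in> quotient_space W"
    using comb by (auto simp: quotient_space_def)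
  show "coset_value f (quotient_comb W S a) = (\<Sum>X\<in>S. row_scale (a X) (coset_value f X))"
    unfolding comb coset_value_coset by (simp add: f.sum f.scale val)
qed

text \<open>So a set of cosets is a basis of the quotient exactly if its values are a basis of the
  range, where the library's theory of bases applies.\<close>

lemma quotient_basis_iff:
  assumes B: "B \<subseteq> quotient_space W"
  shows "quotient_basis W B \<longleftrightarrow>
    row_space.independent (coset_value f ` B) \<and> row_space.span (coset_value f ` B) = range f"
proof -
  let ?q = "coset_value f"
  have inj: "inj_on ?q S" if "S \<subseteq> B" for S
    using inj_on_coset_value B that by (meson inj_on_subset subset_trans)
  have W_space: "W \<in> quotient_space W" and qW: "?q W = 0"
    using coset_value_coset[of 0] f.zero
    by (auto simp: quotient_space_def intro!: exI[of _ 0])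
  have comb_eq: "quotient_comb W S a = Y \<longleftrightarrow> (\<Sum>X\<in>S. row_scale (a X) (?q X)) = ?q Y"
    if "finite S" "S \<subseteq> B" "Y \<in> quotient_space W" for S a Y
  proof -
    have "S \<subseteq> quotient_space W" using that(2) B by (rule subset_trans)
    note comb = quotient_comb_in_quotient_space[OF that(1) this, of a]
    show ?thesis
      using inj_on_eq_iff[OF inj_on_coset_value comb(1) that(3)] unfolding comb(2) by (rule sym)
  qed
  have indep: "(\<forall>S a. finite S \<and> S \<subseteq> B \<and> quotient_comb W S a = W \<longrightarrow> (\<forall>X\<in>S. a X = 0))
      \<longleftrightarrow> row_space.independent (?q ` B)" (is "?L \<longleftrightarrow> ?R")
  proof
    assume L: ?L
    show ?R
      unfolding row_space.independent_explicit_finite_subsets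
    proof (intro allI impI)
      fix T u assume T: "T \<subseteq> ?q ` B" "finite T" "(\<Sum>v\<in>T. row_scale (u v) v) = 0"
      then obtain S where S: "S \<subseteq> B" "finite S" "T = ?q ` S"
        by (meson finite_subset_image)
      have "(\<Sum>X\<in>S. row_scale (u (?q X)) (?q X)) = 0"
        using T(3) inj[OF S(1)] S(3) by (simp add: sum.reindex)
      then have "quotient_comb W S (u \<circ> ?q) = W"
        using comb_eq[OF S(2,1) W_space, of "u \<circ> ?q"] qW by simp
      then have "\<forall>X\<in>S. (u \<circ> ?q) X = 0" using L S by blast
      then show "\<forall>v\<in>T. u v = 0" using S(3) by simp
    qed
  next
    assume R: ?R
    show ?L
    proof (intro allI impI, elim conjE)
      fix S a assume S: "finite S" "S \<subseteq> B" "quotient_comb W S a = W"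
      let ?u = "a \<circ> the_inv_into S ?q"
      have u: "?u (?q X) = a X" if "X \<in> S" for X
        using that inj[OF S(2)] by (simp add: the_inv_into_f_f)
      have "(\<Sum>X\<in>S. row_scale (a X) (?q X)) = 0"
        using comb_eq[OF S(1,2) W_space] S(3) qW by simp
      then have "(\<Sum>v\<in>?q ` S. row_scale (?u v) v) = 0"
        using u by (simp add: sum.reindex[OF inj[OF S(2)]])
      moreover have "?q ` S \<subseteq> ?q ` B" "finite (?q ` S)" using S(1,2) by auto
      ultimately have "\<forall>v\<in>?q ` S. ?u v = 0"
        using R[unfolded row_space.independent_explicit_finite_subsets, rule_format, of "?q ` S" ?u]
        by blast
      then show "\<forall>X\<in>S. a X = 0" using u by auto
    qed
  qed
  have in_span: "(\<exists>S a. finite S \<and> S \<subseteq> B \<and> Y = quotient_comb W S a)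
      \<longleftrightarrow> ?q Y \<in> row_space.span (?q ` B)" (is "?L \<longleftrightarrow> ?R")
    if Y: "Y \<in> quotient_space W" for Y
  proof
    assume ?L
    then obtain S a where S: "finite S" "S \<subseteq> B" "Y = quotient_comb W S a" by blast
    then have "?q Y = (\<Sum>X\<in>S. row_scale (a X) (?q X))" using comb_eq[OF S(1,2) Y] by metis
    also have "\<dots> \<in> row_space.span (?q ` B)"
      using S(2) by (intro row_space.span_sum row_space.span_scale row_space.span_base) auto
    finally show ?R .
  next
    assume ?R
    then obtain T u where T: "finite T" "T \<subseteq> ?q ` B" "?q Y = (\<Sum>v\<in>T. row_scale (u v) v)"
      unfolding row_space.span_explicit by blast
    then obtain S where S: "S \<subseteq> B" "finite S" "T = ?q ` S"
      by (meson finite_subset_image)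
    then have "(\<Sum>X\<in>S. row_scale ((u \<circ> ?q) X) (?q X)) = ?q Y"
      using T(3) inj[OF S(1)] by (simp add: sum.reindex)
    then have "quotient_comb W S (u \<circ> ?q) = Y" using comb_eq[OF S(2,1) Y] by simp
    then show ?L using S by (intro exI[of _ S] exI[of _ "u \<circ> ?q"]) simp
  qed
  have "row_space.span (?q ` B) \<subseteq> range f"
    using B coset_value_quotient_space f.subspace_image[OF row_space.subspace_UNIV]
    by (intro row_space.span_minimal) auto
  moreover have "(\<forall>Y\<in>quotient_space W. ?q Y \<in> row_space.span (?q ` B))
      \<longleftrightarrow> range f \<subseteq> row_space.span (?q ` B)"
    unfolding coset_value_quotient_space[symmetric] by blast
  ultimately show ?thesis
    using B indep in_span unfolding quotient_basis_def by auto
qed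

text \<open>The choice in \<open>codim\<close> needs some basis to exist, obtained by pulling \<open>E\<close> back to cosets;
  whichever basis is then chosen has values equipotent with \<open>E\<close>.\<close>

lemma codim_kernel:
  assumes E: "row_space.independent E" "row_space.span E = range f"
  shows "|E| =o codim W"
proof -
  let ?q = "coset_value f"
  obtain B where "B \<subseteq> quotient_space W" "?q ` B = E"
    using coset_value_quotient_space E(2) row_space.span_superset
    by (metis subset_imageE)
  then have "quotient_basis W B" using quotient_basis_iff E by simp
  then have basis: "quotient_basis W (SOME B. quotient_basis W B)" (is "quotient_basis W ?B")
    by (rule someI)
  then have B: "?B \<subseteq> quotient_space W" by (simp add: quotient_basis_def)
  obtain g where "bij_betw g E (?q ` ?B)"
    using row_space.bij_if_span_eq_span_bases[of E "?q ` ?B"] E quotient_basis_iff[OF B] basis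
    by metis
  moreover have "bij_betw ?q ?B (?q ` ?B)"
    using inj_on_coset_value B by (simp add: inj_on_imp_bij_betw inj_on_subset)
  ultimately show ?thesis
    unfolding codim_def by (meson card_of_ordIso ordIso_symmetric ordIso_transitive)
qed

end

section \<open>Matrices in quasi-Hermite form\<close>

lemma lookup_beyond_row_length:
  "row_length r < i \<Longrightarrow> Poly_Mapping.lookup r i = 0"
  unfolding row_length_def by (metis Max_ge finite_keys in_keys_iff leD)

lemma quasi_Hermite_pivot_column:
  assumes H: "quasi_Hermite H" and j: "j \<in> nonzero_rows H"
  shows "Poly_Mapping.lookup (H k) (row_length (H j)) = (if k = j then 1 else 0)"
proof -
  consider "k = j" | "j < k" | "k < j" "H k = 0" | "k < j" "k \<in> nonzero_rows H"
    unfolding nonzero_rows_def by fastforce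
  then show ?thesis
  proof cases
    case 4
    then have "row_length (H k) < row_length (H j)"
      using H j unfolding quasi_Hermite_def strict_mono_on_def by blast
    then show ?thesis using 4 by (simp add: lookup_beyond_row_length)
  qed (use H j in \<open>auto simp: quasi_Hermite_def\<close>)
qed

lemma row_of_length_nonzero_row:
  assumes "quasi_Hermite H" "m \<in> length_set H"
  shows "row_of_length H m \<in> nonzero_rows H" "row_length (H (row_of_length H m)) = m"
  using assms row_of_length unfolding length_set_def by fastforce+

text \<open>All other pivot entries of the row vanish, so only its own pivot and non-pivot positions
  contribute.\<close>

lemma quasi_Hermite_row_dot:
  assumes H: "quasi_Hermite H" and j: "j \<in> nonzero_rows H"
  shows "row_dot (H j) x = x (row_length (H j))
    + (\<Sum>s | s < row_length (H j) \<and> s \<notin> length_set H. Poly_Mapping.lookup (H j) s * x s)"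
proof -
  let ?\<rho> = "row_length (H j)" and ?h = "Poly_Mapping.lookup (H j)"
  let ?F = "{s. s < ?\<rho> \<and> s \<notin> length_set H}"
  have zero: "?h i = 0" if "i \<noteq> ?\<rho>" "i \<notin> ?F" for i
  proof (cases "?\<rho> < i")
    case True
    then show ?thesis by (rule lookup_beyond_row_length)
  next
    case False
    then have "i \<in> length_set H" using that by auto
    then show ?thesis
      using quasi_Hermite_pivot_column[OF H, of "row_of_length H i" j]
        row_of_length_nonzero_row[OF H] that(1) by metis
  qed
  then have "Poly_Mapping.keys (H j) \<subseteq> insert ?\<rho> ?F" by (auto simp: in_keys_iff)
  moreover have "finite ?F" by simp
  ultimately have "row_dot (H j) x = (\<Sum>i\<in>insert ?\<rho> ?F. ?h i * x i)"
    by (intro row_dot_superset) auto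
  then show ?thesis using quasi_Hermite_pivot_column[OF H j, of j] by simp
qed

text \<open>The sum in the pivot formula runs over non-pivot positions only, where a solution agrees
  with its parameter \<open>t\<close>; so solving each row for its pivot variable leaves no recursion.\<close>

lemma quasi_Hermite_row_equation:
  assumes H: "quasi_Hermite H"
  shows "H \<odot>v x = \<kappa> \<longleftrightarrow> (\<forall>w\<in>zero_rows H. \<kappa> w = 0) \<and> (\<exists>t. x = general_solution H \<kappa> t)"
proof -
  let ?free = "\<lambda>m y. \<Sum>s | s < m \<and> s \<notin> length_set H.
    Poly_Mapping.lookup (H (row_of_length H m)) s * (y s :: 'a)"
  have rows: "H \<odot>v x = \<kappa> \<longleftrightarrow> (\<forall>w\<in>zero_rows H. \<kappa> w = 0) \<and>
      (\<forall>j\<in>nonzero_rows H. row_dot (H j) x = \<kappa> j)"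
    unfolding fun_eq_iff rf_mult_col_row_dot zero_rows_def nonzero_rows_def
    by (auto simp: row_dot_def) (metis keys_zero sum.empty)+
  have pivots: "(\<forall>j\<in>nonzero_rows H. row_dot (H j) x = \<kappa> j) \<longleftrightarrow>
      (\<forall>m\<in>length_set H. x m = \<kappa> (row_of_length H m) - ?free m x)"
  proof -
    have "length_set H = (\<lambda>j. row_length (H j)) ` nonzero_rows H"
      by (auto simp: length_set_def)
    then show ?thesis
      by (simp add: row_of_length[OF H] quasi_Hermite_row_dot[OF H] eq_diff_eq)
  qed
  have free: "?free m (general_solution H \<kappa> t) = ?free m t" for m t
    by (intro sum.cong) (auto simp: general_solution_def)
  have "(\<forall>m\<in>length_set H. x m = \<kappa> (row_of_length H m) - ?free m x) \<longleftrightarrow>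
      (\<exists>t. x = general_solution H \<kappa> t)"
  proof
    assume "\<forall>m\<in>length_set H. x m = \<kappa> (row_of_length H m) - ?free m x"
    then have "x = general_solution H \<kappa> x"
      by (auto simp: general_solution_def Let_def)
    then show "\<exists>t. x = general_solution H \<kappa> t" by (rule exI[of _ x])
  next
    assume "\<exists>t. x = general_solution H \<kappa> t"
    then obtain t where x: "x = general_solution H \<kappa> t" ..
    show "\<forall>m\<in>length_set H. x m = \<kappa> (row_of_length H m) - ?free m x"
      unfolding x free by (simp add: general_solution_def Let_def)
  qed
  then show ?thesis using rows pivots by simp
qed

lemma particular_solution_eq_general: "particular_solution H \<kappa> = general_solution H \<kappa> (\<lambda>_. 0)"
  by (auto simp: particular_solution_def general_solution_def Let_def)

lemma independent_unit_vectors: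
  "row_space.independent ((\<lambda>m. Poly_Mapping.single m (1::'a::field)) ` M)"
  unfolding row_space.dependent_def
proof
  let ?E = "(\<lambda>m. Poly_Mapping.single m (1::'a)) ` M"
  assume "\<exists>a\<in>?E. a \<in> row_space.span (?E - {a})"
  then obtain m where m:
    "Poly_Mapping.single m (1::'a) \<in> row_space.span (?E - {Poly_Mapping.single m 1})" by blast
  have "row_space.span (?E - {Poly_Mapping.single m 1}) \<subseteq> {v. Poly_Mapping.lookup v m = 0}"
    by (rule row_space.span_minimal)
      (auto simp: row_space.subspace_def lookup_add lookup_single when_def)
  with m show False by auto
qed

text \<open>The kernel of the reduction modulo the pivot rows is the row space, and the unit vectors at
  the non-pivot positions are a basis of its range.\<close>

lemma codim_RS_quasi_Hermite:
  assumes H: "quasi_Hermite (H :: 'a::field rf_matrix)"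
  shows "|UNIV - length_set H| =o codim (RS H)"
proof -
  let ?R = "length_set H"
  \<comment> \<open>The row to be subtracted for each pivot position, with pivot entry \<open>1\<close> there and \<open>0\<close> at
    the other pivots, so that all pivot entries are cleared in one step.\<close>
  define G where "G = (\<lambda>m. if m \<in> ?R then H (row_of_length H m) else 0)"
  define reduce where "reduce = (\<lambda>v. v - row_comb v G)"
  let ?e = "\<lambda>m. Poly_Mapping.single m (1::'a)"
  let ?E = "?e ` (UNIV - ?R)"
  have lin: "Vector_Spaces.linear row_scale row_scale reduce"
    by (simp add: Vector_Spaces.linear_iff row_space.vector_space_axioms reduce_def row_comb_add
        row_comb_scale row_space.scale_right_diff_distrib)
  interpret reduce: Vector_Spaces.linear row_scale row_scale reduce by (rule lin)
  have G_pivot: "Poly_Mapping.lookup (G i) m = (if i = m then 1 else 0)" if "m \<in> ?R" for i m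
    using quasi_Hermite_pivot_column[OF H row_of_length_nonzero_row(1)[OF H that]]
      row_of_length_nonzero_row[OF H] that unfolding G_def by (auto, metis)
  have reduce_pivot: "Poly_Mapping.lookup (reduce v) m = 0" if "m \<in> ?R" for v m
  proof -
    have "Poly_Mapping.lookup (row_comb v G) m
        = (\<Sum>i\<in>Poly_Mapping.keys v. if i = m then Poly_Mapping.lookup v i else 0)"
      unfolding row_comb_def lookup_sum by (intro sum.cong) (auto simp: G_pivot[OF that])
    then show ?thesis by (simp add: reduce_def lookup_minus in_keys_iff)
  qed
  have G_RS: "row_comb v G \<in> RS H" for v
    unfolding row_comb_def RS_def G_def
    by (intro row_space.span_sum row_space.span_scale)
      (auto intro: row_space.span_base row_space.span_zero)
  have row_reduces: "reduce (H j) = 0" for j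
  proof (cases "j \<in> nonzero_rows H")
    case False
    then show ?thesis by (simp add: nonzero_rows_def reduce_def row_comb_def)
  next
    case True
    let ?\<rho> = "row_length (H j)"
    have \<rho>: "?\<rho> \<in> ?R" using True by (auto simp: length_set_def)
    have "row_comb (H j) G = (\<Sum>i\<in>Poly_Mapping.keys (H j). if i = ?\<rho> then H j else 0)"
      unfolding row_comb_def
    proof (intro sum.cong refl)
      fix i assume i: "i \<in> Poly_Mapping.keys (H j)"
      show "row_scale (Poly_Mapping.lookup (H j) i) (G i) = (if i = ?\<rho> then H j else 0)"
      proof (cases "i \<in> ?R")
        case iR: True
        then have "Poly_Mapping.lookup (H j) i = (if j = row_of_length H i then 1 else 0)"
          using quasi_Hermite_pivot_column[OF H row_of_length_nonzero_row(1)[OF H iR], of j]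
            row_of_length_nonzero_row(2)[OF H iR] by simp
        then show ?thesis
          using i iR row_of_length[OF H True] row_of_length_nonzero_row(2)[OF H iR]
          by (auto simp: G_def in_keys_iff split: if_splits)
      next
        case False
        then show ?thesis using \<rho> by (auto simp: G_def)
      qed
    qed
    also have "\<dots> = H j"
      using quasi_Hermite_pivot_column[OF H True, of j] by (simp add: in_keys_iff)
    finally show ?thesis by (simp add: reduce_def)
  qed
  have kernel: "RS H = {v. reduce v = 0}"
  proof
    show "RS H \<subseteq> {v. reduce v = 0}"
      unfolding RS_def using row_reduces reduce.subspace_kernel
      by (intro row_space.span_minimal) auto
    show "{v. reduce v = 0} \<subseteq> RS H"
      using G_RS by (auto simp: reduce_def) metis
  qed
  have range: "row_space.span ?E = range reduce"
  proof
    have "?e m = reduce (?e m)" if "m \<notin> ?R" for m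
      using that by (simp add: reduce_def G_def)
    then have "?E \<subseteq> range reduce" by blast
    then show "row_space.span ?E \<subseteq> range reduce"
      using reduce.subspace_image[OF row_space.subspace_UNIV] by (rule row_space.span_minimal)
    show "range reduce \<subseteq> row_space.span ?E"
    proof (rule image_subsetI)
      fix v
      have "row_comb (reduce v) rf_one \<in> row_space.span ?E"
        unfolding row_comb_def rf_one_def
        using reduce_pivot
        by (intro row_space.span_sum row_space.span_scale row_space.span_base)
          (auto simp: in_keys_iff)
      then show "reduce v \<in> row_space.span ?E" by simp
    qed
  qed
  have "inj_on ?e (UNIV - ?R)"
    by (rule inj_onI) (metis lookup_single_eq lookup_single_not_eq zero_neq_one)
  then have "|UNIV - ?R| =o |?E|"
    using card_of_ordIso inj_on_imp_bij_betw by blast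
  also have "|?E| =o codim (RS H)"
    using lin kernel independent_unit_vectors range by (rule codim_kernel)
  finally (ordIso_transitive) show ?thesis .
qed

text \<open>With all positions pivotal, the homogeneous formula leaves only the zero sequence; a free
  position can be given the value \<open>1\<close>.\<close>

lemma nonzero_homogeneous_solution_iff:
  "(\<exists>t. general_solution H (\<lambda>_. 0) t \<noteq> (\<lambda>_. 0)) \<longleftrightarrow> UNIV - length_set H \<noteq> {}"
proof
  assume "UNIV - length_set H \<noteq> {}"
  then obtain m where "m \<notin> length_set H" by blast
  then have "general_solution H (\<lambda>_. 0) (\<lambda>_. 1) m \<noteq> 0"
    by (simp add: general_solution_def)
  then show "\<exists>t. general_solution H (\<lambda>_. 0) t \<noteq> (\<lambda>_. 0)" by metis
next
  assume nonzero: "\<exists>t. general_solution H (\<lambda>_. 0) t \<noteq> (\<lambda>_. 0)"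
  show "UNIV - length_set H \<noteq> {}"
  proof
    assume "UNIV - length_set H = {}"
    then have "length_set H = UNIV" by blast
    then have "general_solution H (\<lambda>_. 0) t = (\<lambda>_. 0)" for t
      by (simp add: general_solution_def)
    then show False using nonzero by blast
  qed
qed

lemma czero_ordLess_iff: "(czero :: 'b rel) <o |S| \<longleftrightarrow> S \<noteq> {}"
proof -
  have "(czero :: 'b rel) <o |S| \<longleftrightarrow> \<not> |S| \<le>o (czero :: 'b rel)"
    unfolding czero_def by (simp add: not_ordLeq_iff_ordLess card_of_Well_order)
  also have "\<dots> \<longleftrightarrow> S \<noteq> {}"
    unfolding czero_def by (metis card_of_empty card_of_empty3)
  finally show ?thesis .
qed

theorem mainTheorem6:
  fixes A Q H :: "'a::field rf_matrix" and c \<kappa> :: "nat \<Rightarrow> 'a"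
  assumes "nonsingular Q"
    and "H = Q \<odot> A" 
    and "quasi_Hermite H"
    and "\<kappa> = Q \<odot>v c"
  shows "((\<exists>x. A \<odot>v x = c) \<longleftrightarrow> (\<forall>w\<in>zero_rows H. \<kappa> w = 0)) \<and>
    ((\<exists>x. A \<odot>v x = c) \<longrightarrow>
       A \<odot>v particular_solution H \<kappa> = c \<and>
       {x. A \<odot>v x = c} = {general_solution H \<kappa> t |t. True}) \<and>
    {x. A \<odot>v x = (\<lambda>_. 0)} = {general_solution H (\<lambda>_. 0) t |t. True} \<and>
    |UNIV - length_set H| =o deficiency A \<and>
    ((\<exists>x. x \<noteq> (\<lambda>_. 0) \<and> A \<odot>v x = (\<lambda>_. 0)) \<longleftrightarrow> (czero :: nat rel) <o deficiency A)"
proof -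
  have system: "A \<odot>v x = c' \<longleftrightarrow>
      (\<forall>w\<in>zero_rows H. (Q \<odot>v c') w = 0) \<and> (\<exists>t. x = general_solution H (Q \<odot>v c') t)" for x c'
    using nonsingular_mult_col_eq_iff[OF assms(1), of A x c']
      quasi_Hermite_row_equation[OF assms(3)] assms(2) by simp
  have zero_rhs: "Q \<odot>v (\<lambda>_. 0) = (\<lambda>_. 0)"
    by (simp add: rf_mult_col_def)
  have consistent: "(\<exists>x. A \<odot>v x = c) \<longleftrightarrow> (\<forall>w\<in>zero_rows H. \<kappa> w = 0)"
    using system assms(4) by auto
  have solutions: "{x. A \<odot>v x = c} = {general_solution H \<kappa> t |t. True}"
    if "\<exists>x. A \<odot>v x = c"
    using that consistent system assms(4) by auto
  have homogeneous: "A \<odot>v x = (\<lambda>_. 0) \<longleftrightarrow> (\<exists>t. x = general_solution H (\<lambda>_. 0) t)" for x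
    using system[of x "\<lambda>_. 0"] by (simp add: zero_rhs)
  have codim: "|UNIV - length_set H| =o deficiency A"
    using codim_RS_quasi_Hermite[OF assms(3)] RS_nonsingular_mult[OF assms(1)] assms(2)
    by (simp add: deficiency_def)
  have "(czero :: nat rel) <o deficiency A \<longleftrightarrow> (czero :: nat rel) <o |UNIV - length_set H|"
    using codim by (meson ordIso_symmetric ordLess_ordIso_trans)
  then have "(\<exists>x. x \<noteq> (\<lambda>_. 0) \<and> A \<odot>v x = (\<lambda>_. 0)) \<longleftrightarrow> (czero :: nat rel) <o deficiency A"
    using nonzero_homogeneous_solution_iff[of H] homogeneous czero_ordLess_iff by metis
  moreover have "A \<odot>v particular_solution H \<kappa> = c" if "\<exists>x. A \<odot>v x = c"
    using solutions[OF that] unfolding particular_solution_eq_general by blast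
  moreover have "{x. A \<odot>v x = (\<lambda>_. 0)} = {general_solution H (\<lambda>_. 0) t |t. True}"
    using homogeneous by auto
  ultimately show ?thesis using consistent solutions codim by blast
qed

end
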